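(* Let $q$ be a power of $2$ and let $m$ be even. Let $n=q^m-1$ and let $\beta$ be a primitive $n$-th root of unity in $\mathbb{F}_{q^m}$. Put $\delta=q^{\frac{m}{2}}-1$ and assume $\delta\ge 2$. Let $g(x)$ be the generator polynomial of the BCH code $\mathcal{C}_{(q,n,\delta,1,\beta)}$, let $h(x)=(x^n-1)/g(x)$, and let $g^\perp(x)=x^{\deg h(x)}h(x^{-1})/h(0)$ be the generator polynomial of $\mathcal{C}_{(q,n,\delta,1,\beta)}^\perp$. Let $\mathcal{C}'$ denote the cyclic code of length $2n$ over $\mathbb{F}_q$ with generator polynomial $g(x)g^\perp(x)$. Then $\mathcal{C}'$ is a Euclidean self-dual cyclic code with parameters $$[2(q^m-1),\;q^m-1,\;2(q^{\frac{m}{2}}-1)]_q.$$ That is, its minimum distance is exactly $2(q^{\frac m2}-1)$.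
   Context: An $[n,k,d]_q$ code is a $k$-dimensional linear subspace of $\mathbb{F}_q^n$ with minimum Hamming distance $d$. The Euclidean dual is $\mathcal{C}^\perp=\{c\in\mathbb{F}_q^n:\sum_i c_iy_i=0\ \forall y\in\mathcal{C}\}$; $\mathcal{C}$ is Euclidean self-dual if $\mathcal{C}=\mathcal{C}^\perp$. A cyclic code of length $N$ over $\mathbb{F}_q$ is identified with an ideal of $\mathbb{F}_q[x]/\langle x^N-1\rangle$ via $(c_0,\dots,c_{N-1})\mapsto c_0+c_1x+\dots+c_{N-1}x^{N-1}$; its generator polynomial is the unique monic divisor of $x^N-1$ generating it. For $\gcd(n,q)=1$ and $\beta$ a primitive $n$-th root of unity, $m_{\beta^i}(x)$ denotes the minimal polynomial of $\beta^i$ over $\mathbb{F}_q$. For integers $\delta\ge2$ and $b$, the BCH code $\mathcal{C}_{(q,n,\delta,b,\beta)}$ is the cyclic code of length $n$ over $\mathbb{F}_q$ with generator polynomial $\mathrm{lcm}\{m_{\beta^b}(x),\dots,m_{\beta^{b+\delta-2}}(x)\}$. *)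

theory Defs
  imports "Jordan_Normal_Form.VS_Connect" "HOL-Algebra.Ideal"
    "HOL-Computational_Algebra.Polynomial_Factorial"
begin

text \<open>Words of length \<open>N\<close> over the field \<open>'a\<close> are the elements of \<^term>\<open>carrier_vec N\<close>.\<close>

definition linear_code :: "nat \<Rightarrow> 'a::field vec set \<Rightarrow> bool" where
  "linear_code N C \<longleftrightarrow> VectorSpace.subspace class_ring C (module_vec TYPE('a) N)"

definition code_dim :: "nat \<Rightarrow> 'a::field vec set \<Rightarrow> nat" where
  "code_dim N C = vectorspace.dim class_ring ((module_vec TYPE('a) N)\<lparr>carrier := C\<rparr>)"

definition hamming_dist :: "'a vec \<Rightarrow> 'a vec \<Rightarrow> nat" where
  "hamming_dist u v = card {i. i < dim_vec u \<and> u $ i \<noteq> v $ i}"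

text \<open>Only meaningful for codes with at least two words.\<close>

definition min_dist :: "'a vec set \<Rightarrow> nat" where
  "min_dist C = Inf {hamming_dist u v | u v. u \<in> C \<and> v \<in> C \<and> u \<noteq> v}"

definition code_params :: "nat \<Rightarrow> nat \<Rightarrow> nat \<Rightarrow> 'a::field vec set \<Rightarrow> bool" where
  "code_params N k d C \<longleftrightarrow> linear_code N C \<and> code_dim N C = k \<and> min_dist C = d"

definition euclidean_dual :: "nat \<Rightarrow> 'a::field vec set \<Rightarrow> 'a vec set" where
  "euclidean_dual N C = {c \<in> carrier_vec N. \<forall>y\<in>C. c \<bullet> y = 0}"

definition self_dual :: "nat \<Rightarrow> 'a::field vec set \<Rightarrow> bool" where
  "self_dual N C \<longleftrightarrow> C = euclidean_dual N C"

definition word_poly :: "'a::zero vec \<Rightarrow> 'a poly" where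
  "word_poly c = Poly (list_of_vec c)"

definition cyc_modulus :: "nat \<Rightarrow> 'a::field poly" where
  "cyc_modulus N = Polynomial.monom 1 N - 1"

text \<open>The quotient ring of \<open>'a[x]\<close> by \<open>x^N - 1\<close> for \<open>N \<ge> 1\<close>, each residue class being
  represented by its unique member of degree less than \<open>N\<close>.\<close>

definition cyc_ring :: "nat \<Rightarrow> 'a::field poly ring" where
  "cyc_ring N = \<lparr>carrier = {p. degree p < N}, mult = (\<lambda>p r. (p * r) mod cyc_modulus N),
                 one = 1, zero = 0, add = (+)\<rparr>"

definition cyclic_code :: "nat \<Rightarrow> 'a::field vec set \<Rightarrow> bool" where
  "cyclic_code N C \<longleftrightarrow> C \<subseteq> carrier_vec N \<and> ideal (word_poly ` C) (cyc_ring N)"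

definition is_generator_poly :: "nat \<Rightarrow> 'a::field vec set \<Rightarrow> 'a poly \<Rightarrow> bool" where
  "is_generator_poly N C f \<longleftrightarrow>
     cyclic_code N C \<and> lead_coeff f = 1 \<and> f dvd cyc_modulus N \<and>
     word_poly ` C = PIdl\<^bsub>cyc_ring N\<^esub> (f mod cyc_modulus N)"

definition cyclic_code_of :: "nat \<Rightarrow> 'a::field poly \<Rightarrow> 'a vec set" where
  "cyclic_code_of N f =
     {c \<in> carrier_vec N. word_poly c \<in> PIdl\<^bsub>cyc_ring N\<^esub> (f mod cyc_modulus N)}"

definition primitive_unity_root :: "nat \<Rightarrow> 'b::field \<Rightarrow> bool" where
  "primitive_unity_root n \<beta> \<longleftrightarrow> 0 < n \<and> \<beta> ^ n = 1 \<and> (\<forall>k. 0 < k \<and> k < n \<longrightarrow> \<beta> ^ k \<noteq> 1)"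

text \<open>A field extension is given by a field embedding \<open>\<phi>\<close> of the small field \<open>'a\<close> into the
  large field \<open>'b\<close>.\<close>

definition min_poly :: "('a::field \<Rightarrow> 'b::field) \<Rightarrow> 'b \<Rightarrow> 'a poly" where
  "min_poly \<phi> x = (THE p. lead_coeff p = 1 \<and> poly (map_poly \<phi> p) x = 0 \<and>
     (\<forall>f. f \<noteq> 0 \<and> poly (map_poly \<phi> f) x = 0 \<longrightarrow> degree p \<le> degree f))"

text \<open>\<^const>\<open>Lcm\<close> of polynomials over a field is monic (or zero), since it is normalized.\<close>

definition bch_gen_poly ::
  "('a::field_gcd \<Rightarrow> 'b::field) \<Rightarrow> nat \<Rightarrow> int \<Rightarrow> 'b \<Rightarrow> 'a poly" where
  "bch_gen_poly \<phi> \<delta> b \<beta> = Lcm ((\<lambda>i. min_poly \<phi> (\<beta> powi i)) ` {b..b + int \<delta> - 2})"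

definition bch_code ::
  "('a::field_gcd \<Rightarrow> 'b::field) \<Rightarrow> nat \<Rightarrow> nat \<Rightarrow> int \<Rightarrow> 'b \<Rightarrow> 'a vec set" where
  "bch_code \<phi> n \<delta> b \<beta> = cyclic_code_of n (bch_gen_poly \<phi> \<delta> b \<beta>)"

end

theory Submission
  imports Defs "Jordan_Normal_Form.Char_Poly"
begin

text \<open>
  Put \<open>Q = q^(m/2)\<close>. For \<open>1 \<le> i \<le> Q - 2\<close> and \<open>0 \<le> t \<le> 2Q - 4\<close> a congruence \<open>i q^a + t \<equiv> 0\<close> modulo
  \<open>n = Q\<^sup>2 - 1\<close> is impossible for reasons of size, after multiplication by \<open>q^(m-a)\<close> if \<open>a > m/2\<close>. So no
  \<open>\<beta>^(-t)\<close> is a root of \<open>g\<close>, and \<open>g\<^sup>\<bottom>\<close> has the \<open>2Q - 3\<close> consecutive roots \<open>1, \<beta>, \<dots>, \<beta>^(2Q-4)\<close>.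
  Hence \<open>g\<close> divides \<open>g\<^sup>\<bottom>\<close>, and by the BCH bound the nonzero multiples of \<open>g\<^sup>\<bottom>\<close> of degree less than \<open>n\<close>
  have weight at least \<open>2(Q - 1)\<close>, those of \<open>g\<close> weight at least \<open>Q - 1\<close>. A multiple of \<open>g g\<^sup>\<bottom>\<close> of degree
  less than \<open>2n\<close> either folds modulo \<open>x^n - 1\<close> to a nonzero multiple of \<open>g\<^sup>\<bottom>\<close>, or is \<open>v (x^n - 1)\<close> with
  \<open>g\<close> dividing \<open>v\<close>. Self-duality holds because \<open>x^(2n) - 1 = (x^n - 1)\<^sup>2\<close> in characteristic 2, so that the
  check polynomial of \<open>g g\<^sup>\<bottom>\<close> is, up to a constant, the reciprocal of \<open>g g\<^sup>\<bottom>\<close>.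
\<close>

subsection \<open>Cyclic codes\<close>

lemma coeff_word_poly: "coeff (word_poly c) i = (if i < dim_vec c then c $ i else 0)"
  by (simp add: word_poly_def coeff_Poly_eq nth_default_def list_of_vec_index)

lemma degree_word_poly_less:
  assumes "c \<in> carrier_vec N" "0 < N" shows "degree (word_poly c) < N"
  using assms by (intro degree_lessI) (auto simp: coeff_word_poly)

lemma word_poly_vec:
  assumes "\<And>i. N \<le> i \<Longrightarrow> coeff p i = 0" shows "word_poly (vec N (coeff p)) = p"
  using assms by (intro poly_eqI) (auto simp: coeff_word_poly)

lemma word_poly_vec_degree:
  "degree p < N \<Longrightarrow> word_poly (vec N (coeff p)) = p"
  by (rule word_poly_vec) (simp add: coeff_eq_0)

lemma word_poly_eq_iff:
  assumes "u \<in> carrier_vec N" "v \<in> carrier_vec N"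
  shows "word_poly u = word_poly v \<longleftrightarrow> u = v"
proof
  assume "word_poly u = word_poly v"
  show "u = v"
  proof (rule eq_vecI)
    fix i assume "i < dim_vec v"
    then show "u $ i = v $ i"
      using assms arg_cong[OF \<open>word_poly u = word_poly v\<close>, of "\<lambda>p. coeff p i"]
      by (simp add: coeff_word_poly)
  qed (use assms in auto)
qed simp

lemma coeff_cyc_modulus:
  "coeff (cyc_modulus N :: 'a::field poly) i = (if i = N then 1 else 0) - (if i = 0 then 1 else 0)"
  by (simp add: cyc_modulus_def)

lemma degree_cyc_modulus: "degree (cyc_modulus N :: 'a::field poly) = N"
proof (cases "N = 0")
  case False
  then show ?thesis
    by (intro antisym degree_le le_degree) (auto simp: coeff_cyc_modulus)
qed (simp add: cyc_modulus_def)

lemma monic_cyc_modulus: "0 < N \<Longrightarrow> lead_coeff (cyc_modulus N :: 'a::field poly) = 1"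
  by (simp add: degree_cyc_modulus coeff_cyc_modulus)

lemma cyc_modulus_nonzero: "0 < N \<Longrightarrow> cyc_modulus N \<noteq> (0 :: 'a::field poly)"
  using monic_cyc_modulus[of N, where 'a='a] by auto

lemma degree_mod_cyc_modulus: "0 < N \<Longrightarrow> degree (p mod cyc_modulus N :: 'a::field poly) < N"
  using degree_mod_less[of "cyc_modulus N" p] cyc_modulus_nonzero[of N, where 'a='a]
  by (auto simp: degree_cyc_modulus)

lemma cring_cyc_ring:
  assumes N: "0 < N" shows "cring (cyc_ring N :: 'a::field poly ring)"
proof -
  let ?R = "cyc_ring N :: 'a poly ring" and ?M = "cyc_modulus N :: 'a poly"
  have less: "p mod ?M = p" if "degree p < N" for p
    using that by (simp add: mod_poly_less degree_cyc_modulus)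
  show ?thesis
  proof (rule cringI)
    show "abelian_group ?R"
    proof (rule abelian_groupI)
      fix x assume "x \<in> carrier ?R"
      then show "\<exists>y\<in>carrier ?R. y \<oplus>\<^bsub>?R\<^esub> x = \<zero>\<^bsub>?R\<^esub>"
        by (intro bexI[of _ "- x"]) (auto simp: cyc_ring_def)
    qed (use N in \<open>auto simp: cyc_ring_def degree_add_less algebra_simps\<close>)
    show "comm_monoid ?R"
    proof (rule comm_monoidI)
      fix x y z
      show "x \<otimes>\<^bsub>?R\<^esub> y \<otimes>\<^bsub>?R\<^esub> z = x \<otimes>\<^bsub>?R\<^esub> (y \<otimes>\<^bsub>?R\<^esub> z)"
        by (simp add: cyc_ring_def mod_mult_left_eq mod_mult_right_eq mult.assoc)
    qed (use N less in \<open>auto simp: cyc_ring_def degree_mod_cyc_modulus mult.commute\<close>)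
    fix x y z
    show "(x \<oplus>\<^bsub>?R\<^esub> y) \<otimes>\<^bsub>?R\<^esub> z = x \<otimes>\<^bsub>?R\<^esub> z \<oplus>\<^bsub>?R\<^esub> y \<otimes>\<^bsub>?R\<^esub> z"
      by (simp add: cyc_ring_def distrib_right poly_mod_add_left)
  qed
qed

text \<open>Reduction modulo x^N - 1 keeps divisibility by \<open>f\<close>, because
  \<open>f\<close> divides the modulus. Membership in a cyclic code thereby becomes divisibility in
  the polynomial ring.\<close>

lemma cgenideal_cyc_ring:
  fixes f :: "'a::field poly"
  assumes N: "0 < N" and f: "f dvd cyc_modulus N"
  shows "PIdl\<^bsub>cyc_ring N\<^esub> (f mod cyc_modulus N) = {p. degree p < N \<and> f dvd p}"
proof (intro equalityI subsetI)
  fix p assume "p \<in> PIdl\<^bsub>cyc_ring N\<^esub> (f mod cyc_modulus N)"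
  then obtain x where "p = (x * (f mod cyc_modulus N)) mod cyc_modulus N"
    by (auto simp: cgenideal_def cyc_ring_def)
  then show "p \<in> {p. degree p < N \<and> f dvd p}"
    using N f by (auto simp: degree_mod_cyc_modulus dvd_mod_iff)
next
  fix p assume "p \<in> {p. degree p < N \<and> f dvd p}"
  then have p: "degree p < N" "f dvd p" by auto
  from p(2) obtain k where k: "p = f * k" by (elim dvdE)
  have "((k mod cyc_modulus N) * (f mod cyc_modulus N)) mod cyc_modulus N = p mod cyc_modulus N"
    by (simp add: k mod_mult_eq mult.commute)
  also have "\<dots> = p"
    using p(1) by (simp add: mod_poly_less degree_cyc_modulus)
  finally show "p \<in> PIdl\<^bsub>cyc_ring N\<^esub> (f mod cyc_modulus N)"
    using N by (auto simp: cgenideal_def cyc_ring_def degree_mod_cyc_modulus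
        intro!: exI[of _ "k mod cyc_modulus N"])
qed

lemma mem_cyclic_code_of_iff:
  assumes "0 < N" "f dvd cyc_modulus N"
  shows "c \<in> cyclic_code_of N f \<longleftrightarrow> c \<in> carrier_vec N \<and> f dvd word_poly c"
  using assms by (auto simp: cyclic_code_of_def cgenideal_cyc_ring degree_word_poly_less)

lemma vec_mem_cyclic_code_of:
  assumes "0 < N" "f dvd cyc_modulus N" "degree p < N" "f dvd p"
  shows "vec N (coeff p) \<in> cyclic_code_of N f"
  using assms by (simp add: mem_cyclic_code_of_iff word_poly_vec_degree)

lemma is_generator_poly_cyclic_code_of:
  fixes f :: "'a::field poly"
  assumes N: "0 < N" and f: "f dvd cyc_modulus N" and monic: "lead_coeff f = 1"
  shows "is_generator_poly N (cyclic_code_of N f) f"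
proof -
  interpret cring "cyc_ring N :: 'a poly ring" by (rule cring_cyc_ring[OF N])
  have img: "word_poly ` cyclic_code_of N f = PIdl\<^bsub>cyc_ring N\<^esub> (f mod cyc_modulus N)"
  proof (intro equalityI subsetI)
    fix p assume "p \<in> PIdl\<^bsub>cyc_ring N\<^esub> (f mod cyc_modulus N)"
    then have "degree p < N" "f dvd p" using N f by (auto simp: cgenideal_cyc_ring)
    then show "p \<in> word_poly ` cyclic_code_of N f"
      using vec_mem_cyclic_code_of[OF N f] word_poly_vec_degree by (metis image_eqI)
  qed (auto simp: cyclic_code_of_def)
  moreover have "f mod cyc_modulus N \<in> carrier (cyc_ring N)"
    using N by (simp add: cyc_ring_def degree_mod_cyc_modulus)
  ultimately have "ideal (word_poly ` cyclic_code_of N f) (cyc_ring N)"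
    by (simp add: cgenideal_ideal)
  then show ?thesis
    using monic f img by (auto simp: is_generator_poly_def cyclic_code_def cyclic_code_of_def)
qed

lemma cyclic_code_of_smult:
  fixes f :: "'a::field poly"
  assumes "0 < N" "f dvd cyc_modulus N" "a \<noteq> 0"
  shows "cyclic_code_of N (Polynomial.smult a f) = cyclic_code_of N f"
  using assms by (auto simp: mem_cyclic_code_of_iff smult_dvd_iff)

text \<open>Multiplication by \<open>f\<close> maps the words of length N - deg f linearly and
  injectively onto the code, so rank-nullity gives the dimension.\<close>

lemma linear_code_dim_cyclic_code_of:
  fixes f :: "'a::field poly"
  assumes N: "0 < N" and f: "f dvd cyc_modulus N"
  shows "linear_code N (cyclic_code_of N f)" "code_dim N (cyclic_code_of N f) = N - degree f"
proof -
  define k where "k = N - degree f"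
  define T where "T v = vec N (coeff (f * word_poly v))" for v :: "'a vec"
  have f0: "f \<noteq> 0" using f cyc_modulus_nonzero[OF N, where 'a='a] by auto
  have kN: "k + degree f = N"
    using dvd_imp_degree_le[OF f cyc_modulus_nonzero[OF N]] by (simp add: k_def degree_cyc_modulus)
  have add: "word_poly (u + v) = word_poly u + word_poly v"
    if "u \<in> carrier_vec k" "v \<in> carrier_vec k" for u v :: "'a vec"
    using that by (intro poly_eqI) (auto simp: coeff_word_poly)
  have scale: "word_poly (a \<cdot>\<^sub>v u) = Polynomial.smult a (word_poly u)" for a and u :: "'a vec"
    by (intro poly_eqI) (auto simp: coeff_word_poly)
  have small: "coeff (f * word_poly v) i = 0" if "v \<in> carrier_vec k" "N \<le> i" for v i
  \<comment> \<open>For \<open>k = 0\<close> the only word gives the zero polynomial, whose degree 0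
    violates the strict bound \<open>degree (word_poly v) < k\<close> used otherwise.\<close>
  proof (cases "k = 0")
    case True
    then have "word_poly v = 0" using that by (intro poly_eqI) (auto simp: coeff_word_poly)
    then show ?thesis by simp
  next
    case False
    then have "degree (f * word_poly v) < N"
      using degree_word_poly_less[OF that(1)] degree_mult_le[of f "word_poly v"] kN by linarith
    then show ?thesis using that by (simp add: coeff_eq_0)
  qed
  have wT: "word_poly (T v) = f * word_poly v" if "v \<in> carrier_vec k" for v
    unfolding T_def by (rule word_poly_vec) (rule small[OF that])
  interpret V: vec_space "TYPE('a)" k .
  interpret W: vec_space "TYPE('a)" N .
  interpret T: linear_map class_ring "module_vec TYPE('a) k" "module_vec TYPE('a) N" T
  proof unfold_locales
    show "T \<in> LinearCombinations.module_hom class_ring (module_vec TYPE('a) k) (module_vec TYPE('a) N)"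
      by (auto simp: LinearCombinations.module_hom_def module_vec_simps T_def add scale algebra_simps)
  qed
  have im: "T.imT = cyclic_code_of N f"
  proof (intro equalityI subsetI)
    fix c assume "c \<in> T.imT"
    then obtain v where "v \<in> carrier_vec k" "c = T v" by (auto simp: T.im_def module_vec_simps)
    then show "c \<in> cyclic_code_of N f"
      using wT N f by (auto simp: mem_cyclic_code_of_iff) (simp add: T_def)
  next
    fix c assume "c \<in> cyclic_code_of N f"
    then have c: "c \<in> carrier_vec N" "f dvd word_poly c" using N f by (auto simp: mem_cyclic_code_of_iff)
    from c(2) obtain w where w: "word_poly c = f * w" by (elim dvdE)
    have "coeff w i = 0" if "k \<le> i" for i
    proof (cases "w = 0")
      case False
      then have "degree f + degree w < N"
        using degree_word_poly_less[OF c(1) N] f0 by (simp add: w degree_mult_eq)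
      then show ?thesis using that kN by (intro coeff_eq_0) linarith
    qed simp
    then have w': "word_poly (vec k (coeff w)) = w" by (rule word_poly_vec)
    then have "word_poly (T (vec k (coeff w))) = word_poly c" by (simp add: wT w)
    then have "T (vec k (coeff w)) = c"
      using word_poly_eq_iff[OF _ c(1)] by (simp add: T_def)
    then show "c \<in> T.imT" by (auto simp: T.im_def module_vec_simps intro: rev_image_eqI)
  qed
  have ker: "T.kerT = {0\<^sub>v k}"
  proof -
    have "v = 0\<^sub>v k" if "v \<in> carrier_vec k" "T v = 0\<^sub>v N" for v
    proof -
      have "word_poly (0\<^sub>v j :: 'a vec) = 0" for j by (intro poly_eqI) (simp add: coeff_word_poly)
      then have "word_poly v = word_poly (0\<^sub>v k)" using wT[OF that(1)] that(2) f0 by auto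
      then show ?thesis using that(1) word_poly_eq_iff[of v k "0\<^sub>v k"] by simp
    qed
    moreover have "T (0\<^sub>v k) = 0\<^sub>v N" using T.f0_is_0 by (simp add: module_vec_simps)
    ultimately show ?thesis by (auto simp: T.ker_def module_vec_simps)
  qed
  show "linear_code N (cyclic_code_of N f)"
    using T.imT_is_subspace by (simp add: linear_code_def im)
  interpret K: vectorspace class_ring "V.vs T.kerT"
    by (rule V.subspace_is_vs[OF T.kerT_is_subspace])
  \<comment> \<open>The kernel is zero, hence spanned by the empty set.\<close>
  have "K.dim \<le> card ({} :: 'a vec set)"
  proof (rule K.gen_ge_dim)
    show "K.span {} = carrier (V.vs T.kerT)"
    proof -
      have "K.span {} = {\<zero>\<^bsub>V.vs T.kerT\<^esub>}"
        unfolding K.span_def K.lincomb_def by auto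
      then show ?thesis by (simp add: ker module_vec_simps)
    qed
  qed auto
  then have "K.dim = 0" by simp
  then show "code_dim N (cyclic_code_of N f) = N - degree f"
    using T.rank_nullity[OF V.fin_dim] V.dim_is_n \<open>K.dim = 0\<close>
    unfolding im by (simp add: code_dim_def flip: k_def)
qed

subsection \<open>Duals of cyclic codes\<close>

lemma reflect_cyc_modulus:
  assumes "0 < N" shows "reflect_poly (cyc_modulus N) = - (cyc_modulus N :: 'a::field poly)"
  using assms by (intro poly_eqI) (auto simp: coeff_reflect_poly coeff_cyc_modulus degree_cyc_modulus)

text \<open>For deg p \<le> N this is x^N p(1/x), the reversal of a coefficient list of length N +
  1. Unlike \<open>reflect_poly\<close>, which forgets powers of x dividing p, it is an involution
  on these polynomials.\<close>

definition padded_reflect :: "nat \<Rightarrow> 'a::field poly \<Rightarrow> 'a poly" where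
  "padded_reflect N p = Polynomial.monom 1 (N - degree p) * reflect_poly p"

lemma coeff_padded_reflect:
  assumes "degree p \<le> N"
  shows "coeff (padded_reflect N p) i = (if i \<le> N then coeff p (N - i) else 0)"
proof (cases "N - degree p \<le> i")
  case True
  then show ?thesis using assms
    by (auto simp: padded_reflect_def coeff_monom_mult coeff_reflect_poly)
next
  case False
  then show ?thesis using assms
    by (auto simp: padded_reflect_def coeff_monom_mult coeff_reflect_poly coeff_eq_0)
qed

lemma degree_padded_reflect: "degree p \<le> N \<Longrightarrow> degree (padded_reflect N p) \<le> N"
  by (intro degree_le) (simp add: coeff_padded_reflect)

lemma padded_reflect_padded_reflect: "degree p \<le> N \<Longrightarrow> padded_reflect N (padded_reflect N p) = p"
  by (intro poly_eqI) (auto simp: coeff_padded_reflect degree_padded_reflect coeff_eq_0)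

lemma padded_reflect_degree: "padded_reflect (degree p) p = reflect_poly p"
  by (simp add: padded_reflect_def)

lemma padded_reflect_mult:
  assumes "degree p \<le> a" "degree r \<le> b"
  shows "padded_reflect (a + b) (p * r) = padded_reflect a p * padded_reflect b r"
proof (cases "p = 0 \<or> r = 0")
  case False
  have "a + b - (degree p + degree r) = (a - degree p) + (b - degree r)" using assms by simp
  then have "Polynomial.monom (1::'a) (a + b - (degree p + degree r)) =
      Polynomial.monom 1 (a - degree p) * Polynomial.monom 1 (b - degree r)"
    by (simp add: mult_monom)
  then show ?thesis using False
    by (simp add: padded_reflect_def degree_mult_eq reflect_poly_mult)
qed (auto simp: padded_reflect_def)

text \<open>Reversal is multiplicative when the lengths add up, and \<open>h\<close> padded to its
  own degree is \<open>reflect_poly h\<close>.\<close>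

lemma padded_reflect_dvd:
  assumes "h dvd p" "degree p \<le> N"
  shows "reflect_poly h dvd padded_reflect N p"
proof (cases "p = 0")
  case False
  from assms(1) obtain u where "p = h * u" by (elim dvdE)
  then have p: "p = u * h" by (simp add: mult.commute)
  with False have deg: "degree u + degree h \<le> N" using assms(2) by (auto simp: degree_mult_eq)
  have "padded_reflect N p = padded_reflect (N - degree h) u * reflect_poly h"
    using padded_reflect_mult[of u "N - degree h" h "degree h"] deg
    by (simp add: p padded_reflect_degree)
  then show ?thesis by simp
qed (simp add: padded_reflect_def)

text \<open>Convolving y with the reversal of c pairs c_i with y_i exactly at position N -
  1.\<close>

lemma scalar_prod_eq_coeff:
  fixes c y :: "'a::field vec"
  assumes "c \<in> carrier_vec N" "y \<in> carrier_vec N" "0 < N"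
  shows "c \<bullet> y = coeff (padded_reflect (N - 1) (word_poly c) * word_poly y) (N - 1)"
proof -
  have deg: "degree (word_poly c) \<le> N - 1" using degree_word_poly_less[OF assms(1,3)] by simp
  have "c \<bullet> y = (\<Sum>i = 0..<N. c $ i * y $ i)" using assms by (simp add: scalar_prod_def)
  also have "\<dots> = (\<Sum>i \<le> N - 1. c $ (N - 1 - i) * y $ (N - 1 - i))"
    by (rule sum.reindex_bij_witness[of _ "\<lambda>i. N - 1 - i" "\<lambda>i. N - 1 - i"]) (use assms in auto)
  also have "\<dots> = coeff (padded_reflect (N - 1) (word_poly c) * word_poly y) (N - 1)"
    unfolding coeff_mult using assms
    by (intro sum.cong) (auto simp: coeff_padded_reflect[OF deg] coeff_word_poly simp del: One_nat_def)
  finally show ?thesis .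
qed

text \<open>The coefficients of \<open>c\<^sup>*(x) g(x)\<close>, with \<open>c\<^sup>*\<close> the reversal of a word \<open>c\<close>, are the inner
  products of \<open>c\<close> with the shifts of \<open>g\<close>; if those at positions \<open>deg g, \<dots>, N - 1\<close> vanish, then
  reduction modulo \<open>x^N - 1\<close> leaves a multiple of \<open>g\<close> of degree less than \<open>deg g\<close>, that is, zero.\<close>

lemma check_poly_dvd_of_coeffs_zero:
  fixes g h r :: "'a::field poly"
  assumes gh: "g * h = cyc_modulus N" and N: "0 < N" and deg: "degree r < N"
    and zero: "\<And>i. degree g \<le> i \<Longrightarrow> i < N \<Longrightarrow> coeff (r * g) i = 0"
  shows "h dvd r"
proof -
  define L where "L = poly_cutoff N (r * g)"
  define U where "U = poly_shift N (r * g)"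
  have g0: "g \<noteq> 0" using gh cyc_modulus_nonzero[OF N, where 'a='a] by auto
  have split: "r * g = L + Polynomial.monom 1 N * U"
    by (intro poly_eqI) (auto simp: L_def U_def coeff_poly_cutoff coeff_poly_shift coeff_monom_mult)
  have LU: "L + U = r * g - U * cyc_modulus N"
    unfolding split cyc_modulus_def by (simp add: algebra_simps)
  also have "\<dots> = g * (r - U * h)"
    by (simp flip: gh add: algebra_simps)
  finally have dvd: "g dvd L + U" by simp
  have "L + U = 0"
  proof (rule ccontr)
    assume "L + U \<noteq> 0"
    then have "degree g \<le> degree (L + U)" using dvd by (rule dvd_imp_degree_le[rotated])
    \<comment> \<open>\<open>U\<close> vanishes here because r g has degree below N + deg g, and
      \<open>L\<close> by the assumption on the coefficients.\<close>
    moreover have "coeff (L + U) i = 0" if "degree g \<le> i" for i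
    proof -
      have "degree (r * g) < i + N" using degree_mult_le[of r g] deg that by linarith
      then have "coeff U i = 0" by (simp add: U_def coeff_poly_shift coeff_eq_0)
      moreover have "coeff L i = 0" using zero that by (simp add: L_def coeff_poly_cutoff)
      ultimately show ?thesis by simp
    qed
    ultimately show False using \<open>L + U \<noteq> 0\<close> by (metis leading_coeff_0_iff)
  qed
  then have "g * r = g * (U * h)" using LU by (simp flip: gh add: algebra_simps)
  then show ?thesis using g0 by simp
qed

text \<open>Orthogonality to the shifts of \<open>g\<close> means that \<open>h\<close> divides the
  reversal of c. Undoing the reversal replaces \<open>h\<close> by
  \<open>reflect_poly h\<close>.\<close>

lemma euclidean_dual_cyclic_code_of:
  fixes g h :: "'a::field poly"
  assumes gh: "g * h = cyc_modulus N" and N: "0 < N"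
  shows "euclidean_dual N (cyclic_code_of N g) = cyclic_code_of N (reflect_poly h)"
proof -
  let ?R = "\<lambda>c. padded_reflect (N - 1) (word_poly c)"
  have nz: "g \<noteq> 0" "h \<noteq> 0" using gh cyc_modulus_nonzero[OF N, where 'a='a] by auto
  then have deg: "degree g + degree h = N"
    using arg_cong[OF gh, of degree] by (simp add: degree_mult_eq degree_cyc_modulus)
  have gM: "g dvd cyc_modulus N" using gh by (metis dvd_triv_left)
  have "coeff g 0 * coeff h 0 = - 1"
    using arg_cong[OF gh, of "\<lambda>p. coeff p 0"] N by (simp add: coeff_mult coeff_cyc_modulus)
  then have h0: "coeff h 0 \<noteq> 0" by auto
  have "reflect_poly h dvd reflect_poly (cyc_modulus N)"
    by (simp flip: gh add: reflect_poly_mult)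
  then have hM: "reflect_poly h dvd cyc_modulus N" using N by (simp add: reflect_cyc_modulus)
  have wdeg: "degree (word_poly c) \<le> N - 1" if "c \<in> carrier_vec N" for c :: "'a vec"
    using degree_word_poly_less[OF that N] by simp
  \<comment> \<open>Each direction is one reversal. From left to right, h(0) being nonzero ensures
    that reflecting \<open>h\<close> twice gives \<open>h\<close> back.\<close>
  have refl: "reflect_poly h dvd word_poly c \<longleftrightarrow> h dvd ?R c" if "c \<in> carrier_vec N" for c
    using padded_reflect_dvd[OF _ wdeg[OF that], of "reflect_poly h"]
      padded_reflect_dvd[OF _ degree_padded_reflect[OF wdeg[OF that]], of h]
      h0 padded_reflect_padded_reflect[OF wdeg[OF that]] by auto
  have dual_iff: "c \<in> euclidean_dual N (cyclic_code_of N g) \<longleftrightarrow> h dvd ?R c" if c: "c \<in> carrier_vec N" for c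
  proof
    assume dual: "c \<in> euclidean_dual N (cyclic_code_of N g)"
    show "h dvd ?R c"
    proof (rule check_poly_dvd_of_coeffs_zero[OF gh N])
      show "degree (?R c) < N" using degree_padded_reflect[OF wdeg[OF c]] N by linarith
      fix i assume i: "degree g \<le> i" "i < N"
      \<comment> \<open>This shift moves position i to position N - 1, where the inner product is
        read off; deg g \<le> i keeps its degree below N.\<close>
      define y where "y = Polynomial.monom 1 (N - 1 - i) * g"
      have "degree y < N"
        using i nz by (simp add: y_def degree_mult_eq degree_monom_eq)
      then have y: "vec N (coeff y) \<in> cyclic_code_of N g" "word_poly (vec N (coeff y)) = y"
        using vec_mem_cyclic_code_of[OF N gM] word_poly_vec_degree by (auto simp: y_def)
      have "0 = c \<bullet> vec N (coeff y)" using dual y(1) by (simp add: euclidean_dual_def)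
      also have "\<dots> = coeff (?R c * y) (N - 1)"
        using scalar_prod_eq_coeff[OF c _ N, of "vec N (coeff y)"] y(2) by simp
      also have "?R c * y = Polynomial.monom 1 (N - 1 - i) * (?R c * g)"
        by (simp add: y_def algebra_simps)
      also have "coeff \<dots> (N - 1) = coeff (?R c * g) i"
        using i by (simp add: coeff_monom_mult)
      finally show "coeff (?R c * g) i = 0" by simp
    qed
  next
    assume "h dvd ?R c"
    then obtain u where u: "?R c = h * u" by (elim dvdE)
    have "c \<bullet> y = 0" if y: "y \<in> cyclic_code_of N g" for y
    proof -
      have y': "y \<in> carrier_vec N" "g dvd word_poly y" using y N gM by (auto simp: mem_cyclic_code_of_iff)
      from y'(2) obtain v where v: "word_poly y = g * v" by (elim dvdE)
      have "?R c * word_poly y = (g * h) * (u * v)" unfolding u v by (simp only: ac_simps)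
      then have eq: "?R c * word_poly y = Polynomial.monom 1 N * (u * v) - u * v"
        unfolding gh cyc_modulus_def by (simp add: algebra_simps)
      \<comment> \<open>Both h u and g v have degree at most N - 1, and deg g + deg h = N, so u v
        has degree at most N - 2 unless it is zero.\<close>
      have "coeff (u * v) (N - 1) = 0"
      proof (cases "u * v = 0")
        case False
        have "degree h + degree u \<le> N - 1"
          using degree_padded_reflect[OF wdeg[OF c]] False nz unfolding u by (simp add: degree_mult_eq)
        moreover have "degree g + degree v \<le> N - 1"
          using wdeg[OF y'(1)] False nz by (simp add: v degree_mult_eq)
        ultimately have "degree (u * v) < N - 1"
          using False deg N by (simp add: degree_mult_eq)
        then show ?thesis by (rule coeff_eq_0)
      qed auto
      then show ?thesis
        using scalar_prod_eq_coeff[OF c y'(1) N] N unfolding eq by (simp add: coeff_monom_mult)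
    qed
    then show "c \<in> euclidean_dual N (cyclic_code_of N g)" using c by (simp add: euclidean_dual_def)
  qed
  show ?thesis
  proof (rule Set.set_eqI)
    fix c
    show "c \<in> euclidean_dual N (cyclic_code_of N g) \<longleftrightarrow> c \<in> cyclic_code_of N (reflect_poly h)"
    proof (cases "c \<in> carrier_vec N")
      case True
      then show ?thesis using dual_iff refl N hM by (simp add: mem_cyclic_code_of_iff)
    qed (simp add: mem_cyclic_code_of_iff N hM euclidean_dual_def)
  qed
qed

subsection \<open>The BCH bound\<close>

definition hweight :: "'a::zero poly \<Rightarrow> nat" where
  "hweight p = card {i. coeff p i \<noteq> 0}"

lemma finite_coeff_support: "finite {i. coeff p i \<noteq> 0}"
  by (rule finite_subset[of _ "{..degree p}"]) (auto simp: le_degree)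

lemma primitive_unity_root_power_eq_1_iff:
  assumes "primitive_unity_root n \<beta>"
  shows "\<beta> ^ k = 1 \<longleftrightarrow> n dvd k"
proof
  have n: "0 < n" "\<beta> ^ n = 1" using assms by (auto simp: primitive_unity_root_def)
  have "\<beta> ^ k = \<beta> ^ (n * (k div n) + k mod n)" by simp
  also have "\<dots> = \<beta> ^ (k mod n)" unfolding power_add power_mult n by simp
  finally have k: "\<beta> ^ k = \<beta> ^ (k mod n)" .
  { assume "\<beta> ^ k = 1"
    then show "n dvd k" using assms k n
      by (metis dvd_eq_mod_eq_0 mod_less_divisor not_gr_zero primitive_unity_root_def) }
  assume "n dvd k"
  then show "\<beta> ^ k = 1" using k by simp
qed

lemma primitive_unity_root_nonzero: "primitive_unity_root n \<beta> \<Longrightarrow> \<beta> \<noteq> 0"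
  by (auto simp: primitive_unity_root_def power_0_left)

lemma primitive_unity_root_power_inj:
  assumes "primitive_unity_root n \<beta>" "i < n" "j < n" "\<beta> ^ i = \<beta> ^ j"
  shows "i = j"
proof -
  have *: "i = j" if "i \<le> j" "j < n" "\<beta> ^ i = \<beta> ^ j" for i j
  proof -
    have "\<beta> ^ i * \<beta> ^ (j - i) = \<beta> ^ i * 1" unfolding power_add[symmetric] using that by simp
    then have "n dvd j - i"
      using primitive_unity_root_nonzero[OF assms(1)]
      by (simp add: primitive_unity_root_power_eq_1_iff[OF assms(1)])
    then show ?thesis using that by (auto dest: dvd_imp_le)
  qed
  then show ?thesis using assms by (metis nat_le_linear)
qed

text \<open>If \<open>p\<close> had at most \<open>w\<close> nonzero coefficients, then a combination of the given equations, with
  coefficients from the polynomial vanishing at all but one of the points \<open>\<beta>^i\<close> for \<open>i\<close> in the support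
  of \<open>p\<close>, would isolate a single coefficient.\<close>

lemma bch_bound:
  fixes p :: "'b::field poly"
  assumes \<beta>: "primitive_unity_root n \<beta>" and p: "p \<noteq> 0" "degree p < n"
    and roots: "\<And>i. b \<le> i \<Longrightarrow> i < b + w \<Longrightarrow> poly p (\<beta> ^ i) = 0"
  shows "w < hweight p"
proof (rule ccontr)
  assume "\<not> w < hweight p"
  define S where "S = {i. coeff p i \<noteq> 0}"
  have S: "finite S" "card S \<le> w"
    using \<open>\<not> w < hweight p\<close> finite_coeff_support[of p] by (auto simp: S_def hweight_def)
  have Sn: "i < n" if "i \<in> S" for i using that p(2) le_degree[of p i] by (auto simp: S_def)
  define j where "j = degree p"
  have j: "j \<in> S" using p by (simp add: j_def S_def)
  define f where "f = (\<Prod>i\<in>S - {j}. [:- (\<beta> ^ i), 1:])"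
  \<comment> \<open>At most w support points with one removed leave deg f < w, so the exponents b +
    k with k \<le> deg f stay among the w given roots.\<close>
  have "degree f = card (S - {j})"
    by (simp add: f_def degree_prod_eq_sum_degree)
  then have deg: "degree f < w" using S j by (metis card_Diff1_less less_le_trans)
  have "(\<Sum>i\<in>S. coeff p i * \<beta> ^ (b * i) * poly f (\<beta> ^ i)) =
      (\<Sum>i\<in>S. \<Sum>k\<le>degree f. coeff f k * (coeff p i * (\<beta> ^ (b + k)) ^ i))"
    by (simp add: poly_altdef sum_distrib_left power_add power_mult power_mult_distrib ac_simps
          flip: power_mult)
  also have "\<dots> = (\<Sum>k\<le>degree f. coeff f k * (\<Sum>i\<in>S. coeff p i * (\<beta> ^ (b + k)) ^ i))"
    by (subst sum.swap) (simp add: sum_distrib_left)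
  also have "\<dots> = (\<Sum>k\<le>degree f. coeff f k * poly p (\<beta> ^ (b + k)))"
    unfolding poly_altdef[of p]
    by (intro sum.cong arg_cong2[where f="(*)"] refl sum.mono_neutral_left)
      (auto simp: S_def le_degree)
  also have "\<dots> = 0" using roots deg by (intro sum.neutral) auto
  also have "(\<Sum>i\<in>S. coeff p i * \<beta> ^ (b * i) * poly f (\<beta> ^ i)) =
      coeff p j * \<beta> ^ (b * j) * poly f (\<beta> ^ j)"
  proof (subst sum.remove[OF S(1) j], rule trans[OF arg_cong2[where f="(+)", OF refl sum.neutral]])
    show "\<forall>i\<in>S - {j}. coeff p i * \<beta> ^ (b * i) * poly f (\<beta> ^ i) = 0"
      using S by (auto simp: f_def poly_prod intro!: prod_zero bexI)
  qed simp
  finally have "poly f (\<beta> ^ j) = 0"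
    using j primitive_unity_root_nonzero[OF \<beta>] by (simp add: S_def)
  then obtain i where "i \<in> S - {j}" "\<beta> ^ j = \<beta> ^ i"
    using S by (auto simp: f_def poly_prod)
  then show False using primitive_unity_root_power_inj[OF \<beta>, of j i] Sn j by auto
qed

subsection \<open>Minimal polynomials over finite fields\<close>

text \<open>The definite description has to be justified first: two monic annihilators of least
  degree differ by an annihilator of smaller degree, which must be zero. Division with remainder
  then does the rest.\<close>

lemma min_poly_dvd_iff:
  fixes \<phi> :: "'a::field \<Rightarrow> 'b::field"
  assumes hom: "field_hom \<phi>" and alg: "\<exists>f. f \<noteq> 0 \<and> poly (map_poly \<phi> f) x = 0"
  shows "min_poly \<phi> x dvd f \<longleftrightarrow> poly (map_poly \<phi> f) x = 0"
proof -
  interpret field_hom \<phi> by (rule hom)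
  interpret P: map_poly_idom_hom \<phi> ..
  let ?Q = "\<lambda>f. f \<noteq> 0 \<and> poly (map_poly \<phi> f) x = 0"
  let ?min = "\<lambda>p. lead_coeff p = 1 \<and> poly (map_poly \<phi> p) x = 0 \<and> (\<forall>f. ?Q f \<longrightarrow> degree p \<le> degree f)"
  obtain p0 where p0: "?Q p0" "\<forall>f. ?Q f \<longrightarrow> degree p0 \<le> degree f"
    using exists_least_iff[of "\<lambda>d. \<exists>f. ?Q f \<and> degree f = d"] alg by (metis linorder_not_less)
  have ex: "?min (Polynomial.smult (inverse (lead_coeff p0)) p0)"
    using p0 by (simp add: map_poly_hom_smult)
  have uniq: "p = r" if "?min p" "?min r" for p r
  proof (rule ccontr)
    assume "p \<noteq> r"
    have "?Q p" "?Q r" using that by auto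
    then have "degree p = degree r" using that by (blast intro: antisym)
    then have "p - r = 0 \<or> degree (p - r) < degree p"
      using that by (intro eq_zero_or_degree_less) (auto intro: degree_diff_le)
    then have less: "degree (p - r) < degree p" using \<open>p \<noteq> r\<close> by simp
    have "?Q (p - r)" using that \<open>p \<noteq> r\<close> by (simp add: P.hom_minus)
    then have "degree p \<le> degree (p - r)" using that(1) by blast
    with less show False by simp
  qed
  have "?min (min_poly \<phi> x)"
    unfolding min_poly_def by (rule theI[of ?min, OF ex]) (rule uniq[OF _ ex])
  then have m: "lead_coeff (min_poly \<phi> x) = 1" "poly (map_poly \<phi> (min_poly \<phi> x)) x = 0"
    "\<And>f. ?Q f \<Longrightarrow> degree (min_poly \<phi> x) \<le> degree f" by auto
  have m0: "min_poly \<phi> x \<noteq> 0" using m(1) by auto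
  have "poly (map_poly \<phi> f) x =
      poly (map_poly \<phi> (min_poly \<phi> x * (f div min_poly \<phi> x) + f mod min_poly \<phi> x)) x"
    by simp
  also have "\<dots> = poly (map_poly \<phi> (f mod min_poly \<phi> x)) x"
    by (simp only: P.hom_add P.hom_mult poly_add poly_mult m(2) mult_zero_left add_0_left)
  finally have eq: "poly (map_poly \<phi> f) x = poly (map_poly \<phi> (f mod min_poly \<phi> x)) x" .
  show "min_poly \<phi> x dvd f \<longleftrightarrow> poly (map_poly \<phi> f) x = 0"
  proof
    assume "min_poly \<phi> x dvd f"
    then show "poly (map_poly \<phi> f) x = 0" using eq by simp
  next
    assume "poly (map_poly \<phi> f) x = 0"
    then have "f mod min_poly \<phi> x = 0"
      using m(3)[of "f mod min_poly \<phi> x"] eq degree_mod_less[OF m0, of f] by force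
    then show "min_poly \<phi> x dvd f" by auto
  qed
qed

text \<open>Multiplication by a nonzero \<open>a\<close> permutes the nonzero elements, so their
  product, which is nonzero, is unchanged by the factor a^(q-1).\<close>

lemma finite_field_power_card:
  fixes a :: "'a::{field,finite}"
  shows "a ^ card (UNIV :: 'a set) = a"
proof (cases "a = 0")
  case False
  let ?S = "UNIV - {0::'a}"
  have "(\<Prod>x\<in>?S. a * x) = (\<Prod>x\<in>?S. x)"
    by (rule prod.reindex_bij_witness[of _ "\<lambda>x. x / a" "\<lambda>x. a * x"]) (use False in auto)
  then have "a ^ card ?S * \<Prod>?S = 1 * \<Prod>?S" by (simp add: prod.distrib)
  moreover have "\<Prod>?S \<noteq> 0" by simp
  ultimately have "a ^ card ?S = 1" by (metis mult_right_cancel)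
  moreover have "card (UNIV :: 'a set) = Suc (card ?S)"
    using card_Suc_Diff1[of "UNIV :: 'a set" 0] by simp
  ultimately show ?thesis by (simp only: power_Suc mult_1_right)
qed (simp add: card_gt_0_iff)

text \<open>Translation by 1 permutes the field, so comparing the sums of all elements gives 2^k = 0
  in the field.\<close>

lemma CHAR_eq_2:
  assumes "card (UNIV :: 'a::{field,finite} set) = 2 ^ k"
  shows "CHAR('a) = 2"
proof -
  have "(\<Sum>x\<in>(UNIV :: 'a set). x + 1) = \<Sum>UNIV"
    by (rule sum.reindex_bij_witness[of _ "\<lambda>x. x - 1" "\<lambda>x. x + 1"]) auto
  then have "of_nat (card (UNIV :: 'a set)) = (0::'a)" by (simp add: sum.distrib)
  then have "(2::'a) ^ k = 0" unfolding assms by simp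
  then have "of_nat 2 = (0::'a)" by simp
  then have "CHAR('a) dvd 2" by (simp only: of_nat_eq_0_iff_char_dvd)
  moreover have "CHAR('a) \<noteq> 1" by simp
  ultimately show ?thesis using prime_nat_iff two_is_prime_nat by blast
qed

text \<open>The product of \<open>x - \<gamma>\<close> over the conjugates \<open>\<gamma>\<close> of \<open>y\<close> is fixed by Frobenius, hence has
  coefficients in the small field.\<close>

lemma min_poly_root_conjugate:
  fixes \<phi> :: "'a::{field,finite} \<Rightarrow> 'b::field"
  assumes hom: "field_hom \<phi>" and q: "card (UNIV :: 'a set) = 2 ^ s" "CHAR('b) = 2"
    and y: "y ^ (card (UNIV :: 'a set) ^ m) = y" and m: "0 < m"
    and root: "poly (map_poly \<phi> (min_poly \<phi> y)) z = 0"
  obtains a where "a < m" "z = y ^ (card (UNIV :: 'a set) ^ a)"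
proof -
  interpret field_hom \<phi> by (rule hom)
  interpret P: map_poly_idom_hom \<phi> ..
  let ?q = "card (UNIV :: 'a set)"
  define F where "F = (\<Prod>a<m. [:- (y ^ (?q ^ a)), 1:])"
  have q0: "?q \<noteq> 0" by (auto simp: card_eq_0_iff)
  have frob_add: "(u + v) ^ ?q = u ^ ?q + v ^ ?q" for u v :: 'b
    using freshmans_dream'[of ?q s u v] q by simp
  have neg: "(- u) ^ ?q = - (u ^ ?q)" for u :: 'b
    using frob_add[of u "- u"] q0 by (simp add: power_0_left eq_neg_iff_add_eq_0 add.commute)
  interpret Fr: idom_hom "\<lambda>u::'b. u ^ ?q"
    by unfold_locales (auto simp: frob_add power_mult_distrib power_0_left)
  interpret FP: map_poly_idom_hom "\<lambda>u::'b. u ^ ?q" ..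
  \<comment> \<open>Frobenius moves the exponent a to a + 1. Multiplying by the factor of
    \<open>y\<close> and using y^(q^m) = y closes the cycle, even if some conjugates repeat.\<close>
  have "map_poly (\<lambda>u. u ^ ?q) F = (\<Prod>a<m. [:- (y ^ (?q ^ Suc a)), 1:])"
    by (simp add: F_def FP.hom_prod neg ac_simps flip: power_mult)
  also have "\<dots> * [:- y, 1:] = (\<Prod>a<Suc m. [:- (y ^ (?q ^ a)), 1:])"
    by (subst prod.lessThan_Suc_shift) (simp add: mult.commute)
  also have "\<dots> = F * [:- y, 1:]" using y by (simp add: F_def)
  finally have fix_F: "map_poly (\<lambda>u. u ^ ?q) F = F"
    using mult_right_cancel[of "[:- y, 1:]"] by (simp only: pCons_eq_0_iff) simp
  have inj: "inj \<phi>" by (rule injI) simp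
  \<comment> \<open>X^q - X has at most q roots, and the image of the small field already supplies q
    of them.\<close>
  have range: "u \<in> range \<phi>" if "u ^ ?q = u" for u
  proof -
    let ?X = "Polynomial.monom 1 ?q - Polynomial.monom 1 1 :: 'b poly"
    have "2 \<le> ?q"
      using card_mono[of UNIV "{0, 1::'a}"] by simp
    then have c: "coeff ?X ?q = 1" "degree ?X \<le> ?q"
      by (auto simp: degree_monom_eq intro!: degree_diff_le)
    then have X0: "?X \<noteq> 0" by (metis coeff_0 zero_neq_one)
    have "range \<phi> \<subseteq> {u. poly ?X u = 0}"
      by (auto simp: poly_monom finite_field_power_card simp flip: hom_power)
    moreover have "card (range \<phi>) = ?q" by (rule card_image[OF inj])
    moreover have "card {u. poly ?X u = 0} \<le> ?q"
      using card_poly_roots_bound[OF X0] c by linarith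
    ultimately have "range \<phi> = {u. poly ?X u = 0}"
      using poly_roots_finite[OF X0] by (metis card_seteq)
    then show ?thesis using that by (auto simp: poly_monom)
  qed
  have coeff_range: "coeff F i \<in> range \<phi>" for i
  proof (rule range)
    have "coeff (map_poly (\<lambda>u. u ^ ?q) F) i = coeff F i ^ ?q"
      by (rule coeff_map_poly) (simp add: q0)
    then show "coeff F i ^ ?q = coeff F i" unfolding fix_F by (rule sym)
  qed
  define \<psi> where "\<psi> = inv_into UNIV \<phi>"
  have "\<phi> (\<psi> (coeff F i)) = coeff F i" for i
    using coeff_range[of i] by (simp add: \<psi>_def f_inv_into_f)
  moreover have "\<psi> 0 = 0" unfolding \<psi>_def by (rule inv_f_eq[OF inj hom_zero])
  ultimately have F: "map_poly \<phi> (map_poly \<psi> F) = F"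
    by (intro poly_eqI) (simp add: coeff_map_poly)
  define F0 where "F0 = map_poly \<psi> F"
  have Fy: "poly F y = 0" using m by (auto simp: F_def poly_prod intro!: bexI[of _ 0])
  have "F \<noteq> 0" by (auto simp: F_def)
  then have "F0 \<noteq> 0" using F by (auto simp: F0_def)
  moreover have "poly (map_poly \<phi> F0) y = 0" using F Fy by (simp add: F0_def)
  ultimately have "min_poly \<phi> y dvd F0" using min_poly_dvd_iff[OF hom] by blast
  then have "map_poly \<phi> (min_poly \<phi> y) dvd F"
    by (subst F[folded F0_def, symmetric]) (rule P.hom_dvd)
  then have "poly F z = 0" using root by (auto elim: dvdE)
  then show ?thesis using that by (auto simp: F_def poly_prod)
qed

subsection \<open>Weights and minimum distance\<close>

lemma hweight_uminus [simp]: "hweight (- p :: 'a::ab_group_add poly) = hweight p"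
  by (simp add: hweight_def)

lemma hweight_add_le: "hweight (p + r :: 'a::comm_monoid_add poly) \<le> hweight p + hweight r"
proof -
  have "hweight (p + r) \<le> card ({i. coeff p i \<noteq> 0} \<union> {i. coeff r i \<noteq> 0})"
    unfolding hweight_def by (rule card_mono) (auto simp: finite_coeff_support)
  also have "\<dots> \<le> hweight p + hweight r" unfolding hweight_def by (rule card_Un_le)
  finally show ?thesis .
qed

text \<open>Concatenation of two words: the supports lie below n and from n on, hence are
  disjoint.\<close>

lemma hweight_split:
  fixes u v :: "'a::field poly"
  assumes "\<And>i. n \<le> i \<Longrightarrow> coeff u i = 0"
  shows "hweight (u + Polynomial.monom 1 n * v) = hweight u + hweight v"
proof -
  have "{i. coeff (u + Polynomial.monom 1 n * v) i \<noteq> 0} =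
      {i. coeff u i \<noteq> 0} \<union> (\<lambda>i. i + n) ` {i. coeff v i \<noteq> 0}" (is "?L = ?U \<union> ?V")
  proof (intro equalityI subsetI)
    fix i assume "i \<in> ?L"
    then show "i \<in> ?U \<union> ?V" using assms[of i]
      by (cases "i < n") (auto simp: coeff_monom_mult intro!: image_eqI[of _ _ "i - n"])
  next
    fix i assume "i \<in> ?U \<union> ?V"
    moreover have "i < n" if "coeff u i \<noteq> 0" using assms that not_le by blast
    ultimately show "i \<in> ?L" using assms by (auto simp: coeff_monom_mult)
  qed
  moreover have "?U \<inter> ?V = {}" using assms by auto
  moreover have "card ?V = hweight v" by (simp add: hweight_def card_image)
  ultimately show ?thesis
    by (simp add: hweight_def card_Un_disjoint finite_coeff_support)
qed

lemma hamming_dist_eq_hweight: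
  fixes u v :: "'a::field vec"
  assumes "u \<in> carrier_vec N" "v \<in> carrier_vec N"
  shows "hamming_dist u v = hweight (word_poly u - word_poly v)"
  unfolding hamming_dist_def hweight_def
  by (rule arg_cong[of _ _ card]) (use assms in \<open>auto simp: coeff_word_poly\<close>)

text \<open>Differences of codewords are multiples of \<open>f\<close> again, so distances are
  weights; the least one is attained against the zero word.\<close>

lemma min_dist_cyclic_code_of:
  fixes f :: "'a::field poly"
  assumes N: "0 < N" and f: "f dvd cyc_modulus N"
    and lower: "\<And>p. f dvd p \<Longrightarrow> p \<noteq> 0 \<Longrightarrow> degree p < N \<Longrightarrow> d \<le> hweight p"
    and attained: "f dvd p" "p \<noteq> 0" "degree p < N" "hweight p \<le> d"
  shows "min_dist (cyclic_code_of N f) = d"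
  unfolding min_dist_def
proof (rule cInf_eq_minimum)
  let ?c = "vec N (coeff p)"
  have c: "?c \<in> cyclic_code_of N f" "0\<^sub>v N \<in> cyclic_code_of N f" "word_poly ?c = p"
    "word_poly (0\<^sub>v N :: 'a vec) = 0"
  proof -
    show "word_poly (0\<^sub>v N :: 'a vec) = 0" by (intro poly_eqI) (simp add: coeff_word_poly)
    then show "0\<^sub>v N \<in> cyclic_code_of N f" using N f by (simp add: mem_cyclic_code_of_iff)
  qed (use attained N f in \<open>auto simp: vec_mem_cyclic_code_of word_poly_vec_degree\<close>)
  moreover have "?c \<noteq> 0\<^sub>v N" using c attained(2) by metis
  moreover have "d = hamming_dist ?c (0\<^sub>v N)"
    using hamming_dist_eq_hweight[of ?c N "0\<^sub>v N"] c lower[OF attained(1-3)] attained(4) by simp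
  ultimately show "d \<in> {hamming_dist u v |u v.
      u \<in> cyclic_code_of N f \<and> v \<in> cyclic_code_of N f \<and> u \<noteq> v}" by blast
next
  fix x assume "x \<in> {hamming_dist u v |u v.
      u \<in> cyclic_code_of N f \<and> v \<in> cyclic_code_of N f \<and> u \<noteq> v}"
  then obtain u v where uv: "x = hamming_dist u v" "u \<in> carrier_vec N" "v \<in> carrier_vec N"
    "f dvd word_poly u" "f dvd word_poly v" "u \<noteq> v"
    using N f by (auto simp: mem_cyclic_code_of_iff)
  have "degree (word_poly u - word_poly v) < N"
    using degree_word_poly_less[OF _ N] uv by (intro degree_diff_less) auto
  moreover have "word_poly u - word_poly v \<noteq> 0" using uv word_poly_eq_iff by auto
  ultimately show "d \<le> x"
    using lower[of "word_poly u - word_poly v"] uv hamming_dist_eq_hweight[of u N v] by simp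
qed

subsection \<open>Codes of doubled length in characteristic 2\<close>

text \<open>Here \<open>g'\<close> is the monic reciprocal of the check polynomial. Apart from
  characteristic 2, self-duality of the doubled code needs only this factorization, not the roots of
  a BCH code.\<close>

locale cyclic_factorization =
  fixes n :: nat and g h g' :: "'a::field poly"
  assumes n: "0 < n" and gh: "g * h = cyc_modulus n" and monic_g: "lead_coeff g = 1"
    and g'_def: "g' = Polynomial.smult (inverse (coeff h 0)) (reflect_poly h)"
begin

lemma nonzero: "g \<noteq> 0" "h \<noteq> 0"
  using gh cyc_modulus_nonzero[OF n, where 'a='a] by auto

lemma g_dvd: "g dvd cyc_modulus n"
  using gh by (metis dvd_triv_left)

lemma coeff_h_0: "coeff h 0 \<noteq> 0"
proof -
  have "coeff g 0 * coeff h 0 = - 1"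
    using arg_cong[OF gh, of "\<lambda>p. coeff p 0"] n by (simp add: coeff_mult coeff_cyc_modulus)
  then show ?thesis by auto
qed

lemma reflect_h: "reflect_poly h = Polynomial.smult (coeff h 0) g'"
  using coeff_h_0 by (simp add: g'_def)

lemma degree_g': "degree g' = degree h"
  using coeff_h_0 by (simp add: g'_def)

lemma degree_g_h: "degree g + degree h = n"
  using arg_cong[OF gh, of degree] nonzero by (simp add: degree_mult_eq degree_cyc_modulus)

lemma monic_g': "lead_coeff g' = 1"
  using coeff_h_0 by (simp add: g'_def coeff_reflect_poly)

lemma g'_dvd: "g' dvd cyc_modulus n"
proof -
  have "reflect_poly h dvd reflect_poly (cyc_modulus n)"
    by (simp flip: gh add: reflect_poly_mult)
  then show ?thesis
    using n coeff_h_0 by (simp add: reflect_cyc_modulus reflect_h smult_dvd_iff)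
qed

lemma is_generator_poly_dual: "is_generator_poly n (euclidean_dual n (cyclic_code_of n g)) g'"
proof -
  have "euclidean_dual n (cyclic_code_of n g) = cyclic_code_of n g'"
    using euclidean_dual_cyclic_code_of[OF gh n] cyclic_code_of_smult[OF n g'_dvd coeff_h_0]
    by (simp add: reflect_h)
  then show ?thesis using is_generator_poly_cyclic_code_of[OF n g'_dvd monic_g'] by simp
qed

end

locale cyclic_factorization_char_2 = cyclic_factorization n g h g'
  for n :: nat and g h g' :: "'a::field poly" +
  assumes char_2: "CHAR('a) = 2"
begin

lemma cyc_modulus_double: "cyc_modulus (2 * n) = cyc_modulus n * (cyc_modulus n :: 'a poly)"
proof -
  have "(2 :: 'a) = 0" using of_nat_CHAR[where 'a='a] by (simp add: char_2)
  then have two: "(2 :: 'a poly) = 0" by (metis numeral_poly pCons_0_0)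
  have "(x - 1) * (x - 1) = x * x - 2 * x + 1" for x :: "'a poly"
    by (simp add: algebra_simps)
  from this[of "Polynomial.monom 1 n"]
  have "cyc_modulus n * cyc_modulus n = Polynomial.monom 1 (n + n) - 2 * Polynomial.monom 1 n + (1 :: 'a poly)"
    by (simp add: cyc_modulus_def mult_monom)
  \<comment> \<open>Since 2 = 0, the summand 2 only accounts for the change of sign of the constant
    term.\<close>
  also have "\<dots> = Polynomial.monom 1 (2 * n) - 1 + 2"
    by (simp add: two mult_2)
  finally show ?thesis by (simp add: two cyc_modulus_def)
qed

lemma double_dvd: "g * g' dvd cyc_modulus (2 * n)"
  unfolding cyc_modulus_double by (rule mult_dvd_mono[OF g_dvd g'_dvd])

lemma degree_double: "degree (g * g') = n"
  using nonzero degree_g' degree_g_h monic_g' by (subst degree_mult_eq) auto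

lemma is_generator_poly_double: "is_generator_poly (2 * n) (cyclic_code_of (2 * n) (g * g')) (g * g')"
  using n double_dvd monic_g monic_g'
  by (intro is_generator_poly_cyclic_code_of) (auto simp: lead_coeff_mult)

text \<open>With x^n - 1 = g' k, the check polynomial of g g' is h k. Reversal turns h into a
  multiple of g' by definition, and k into a constant multiple of g, as reversing x^n - 1 = g' k and
  cancelling h shows.\<close>

lemma self_dual_double: "self_dual (2 * n) (cyclic_code_of (2 * n) (g * g'))"
proof -
  obtain k where k: "cyc_modulus n = g' * k" using g'_dvd by (elim dvdE)
  have "reflect_poly g' * reflect_poly k = - (g * h)"
    using reflect_cyc_modulus[OF n, where 'a='a] by (simp add: gh k flip: reflect_poly_mult)
  moreover have "reflect_poly g' = Polynomial.smult (inverse (coeff h 0)) h"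
    using coeff_h_0 by (simp add: g'_def reflect_poly_smult)
  ultimately have "h * Polynomial.smult (inverse (coeff h 0)) (reflect_poly k) = h * (- g)"
    by (simp add: mult.commute)
  then have "Polynomial.smult (inverse (coeff h 0)) (reflect_poly k) = - g"
    using nonzero by (metis mult_left_cancel)
  then have "Polynomial.smult (coeff h 0) (- g) =
      Polynomial.smult (coeff h 0 * inverse (coeff h 0)) (reflect_poly k)" by (metis smult_smult)
  then have k': "reflect_poly k = Polynomial.smult (- coeff h 0) g"
    using coeff_h_0 by simp
  have "g * g' * (h * k) = cyc_modulus (2 * n)"
    unfolding cyc_modulus_double by (subst (1) gh[symmetric], subst k) (simp only: ac_simps)
  then have "euclidean_dual (2 * n) (cyclic_code_of (2 * n) (g * g')) =
      cyclic_code_of (2 * n) (reflect_poly (h * k))"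
    using n by (intro euclidean_dual_cyclic_code_of) auto
  also have "reflect_poly (h * k) = Polynomial.smult (- (coeff h 0 * coeff h 0)) (g * g')"
    by (simp add: reflect_poly_mult reflect_h k' mult.commute)
  also have "cyclic_code_of (2 * n) \<dots> = cyclic_code_of (2 * n) (g * g')"
    using n coeff_h_0 by (intro cyclic_code_of_smult double_dvd) auto
  finally show ?thesis by (simp add: self_dual_def)
qed

text \<open>A word of length \<open>2n\<close> divisible by \<open>g g'\<close> either has a nonzero folding modulo \<open>x^n - 1\<close>, which
  is divisible by \<open>g'\<close>, or is \<open>v (x^n - 1)\<close>; in the latter case \<open>g\<close> divides \<open>v h\<close>.\<close>

lemma min_dist_double:
  assumes "g dvd g'"
    and coprime: "\<And>v. g dvd v * h \<Longrightarrow> g dvd v"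
    and bound_g: "\<And>v. g dvd v \<Longrightarrow> v \<noteq> 0 \<Longrightarrow> degree v < n \<Longrightarrow> d \<le> hweight v"
    and bound_g': "\<And>v. g' dvd v \<Longrightarrow> v \<noteq> 0 \<Longrightarrow> degree v < n \<Longrightarrow> 2 * d \<le> hweight v"
    and attained: "g dvd w" "w \<noteq> 0" "degree w < n" "hweight w \<le> d"
  shows "min_dist (cyclic_code_of (2 * n) (g * g')) = 2 * d"
proof (rule min_dist_cyclic_code_of[OF _ double_dvd])
  show "0 < 2 * n" using n by simp
next
  fix p assume p: "g * g' dvd p" "p \<noteq> 0" "degree p < 2 * n"
  define u where "u = poly_cutoff n p"
  define v where "v = poly_shift n p"
  have split: "p = u + Polynomial.monom 1 n * v"
    by (intro poly_eqI) (auto simp: u_def v_def coeff_poly_cutoff coeff_poly_shift coeff_monom_mult)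
  have weight: "hweight p = hweight u + hweight v"
    unfolding split by (rule hweight_split) (simp add: u_def coeff_poly_cutoff)
  have deg: "degree u < n" "degree v < n"
    using n p(3) by (auto intro!: degree_lessI simp: u_def v_def coeff_poly_cutoff coeff_poly_shift coeff_eq_0)
  have uv: "u + v = p - v * cyc_modulus n"
    unfolding split cyc_modulus_def by (simp add: algebra_simps)
  show "2 * d \<le> hweight p"
  proof (cases "u + v = 0")
    case False
    have "g' dvd p" using p(1) by (rule dvd_mult_right)
    then have "g' dvd u + v" unfolding uv by (intro dvd_diff dvd_mult g'_dvd)
    then have "2 * d \<le> hweight (u + v)"
      using False deg by (intro bound_g' degree_add_less) auto
    also have "\<dots> \<le> hweight p" unfolding weight by (rule hweight_add_le)
    finally show ?thesis .
  next
    case True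
    then have u: "u = - v" by (simp add: eq_neg_iff_add_eq_0)
    \<comment> \<open>Cancelling \<open>g\<close> from g g' dividing p leaves g' dividing v h;
      \<open>g\<close> divides \<open>g'\<close>, and the coprimality assumption then removes
      \<open>h\<close>.\<close>
    have "p = g * (v * h)" using uv True gh by (simp add: ac_simps)
    then have "g' dvd v * h" using p(1) nonzero by simp
    then have "g dvd v" using assms(1) coprime dvd_trans by blast
    moreover have "v \<noteq> 0" using p(2) split u by auto
    ultimately have "d \<le> hweight v" using bound_g deg by blast
    then show ?thesis unfolding weight u by simp
  qed
next
  \<comment> \<open>The witness w (x^n - 1) consists of two copies of \<open>w\<close>, up to sign,
    that do not overlap, so it has twice the weight.\<close>
  show "g * g' dvd w * cyc_modulus n" using attained(1) g'_dvd by (rule mult_dvd_mono)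
  show "w * cyc_modulus n \<noteq> 0" using attained(2) cyc_modulus_nonzero[OF n, where 'a='a] by simp
  show "degree (w * cyc_modulus n) < 2 * n"
    using degree_mult_le[of w "cyc_modulus n"] attained(3) by (simp add: degree_cyc_modulus)
  have "w * cyc_modulus n = - w + Polynomial.monom 1 n * w"
    by (simp add: cyc_modulus_def algebra_simps)
  then have "hweight (w * cyc_modulus n) = hweight w + hweight w"
    using hweight_split[of n "- w" w] attained(3) by (simp add: coeff_eq_0)
  then show "hweight (w * cyc_modulus n) \<le> 2 * d" using attained(4) by simp
qed

end

subsection \<open>Dual-containing BCH codes\<close>

lemma poly_cyc_modulus: "poly (cyc_modulus n) x = x ^ n - (1 :: 'a::field)"
  by (simp add: cyc_modulus_def poly_monom)

lemma cyclotomic_exponent_not_dvd: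
  fixes q l i a t :: nat
  assumes q: "2 \<le> q" and Q: "Q = q ^ l" "3 \<le> Q" and i: "1 \<le> i" "i \<le> Q - 2" and t: "t \<le> 2 * Q - 4"
    and a: "a < 2 * l"
  shows "\<not> q ^ (2 * l) - 1 dvd i * q ^ a + t"
proof
  assume dvd: "q ^ (2 * l) - 1 dvd i * q ^ a + t"
  define R where "R = Q - 2"
  define N where "N = q ^ (2 * l) - 1"
  have R: "Q = R + 2" using Q(2) by (simp add: R_def)
  have N: "q ^ (2 * l) = N + 1" using q by (simp add: N_def)
  have "Q * Q = N + 1" using N by (simp add: Q(1) mult_2 power_add)
  \<comment> \<open>R Q and 2 R are the upper bounds for the two summands; together they miss N by
    3.\<close>
  then have RQ: "R * Q + 2 * R + 3 = N" by (simp add: R algebra_simps)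
  have iR: "i \<le> R" and tR: "t \<le> 2 * R" using i t R by simp_all
  have dvd: "N dvd i * q ^ a + t" using dvd by (simp only: N_def)
  show False
  proof (cases "a \<le> l")
    case True
    then have "q ^ a \<le> Q" using q by (simp add: Q(1) power_increasing)
    then have "i * q ^ a \<le> R * Q" using iR by (intro mult_le_mono)
    then have "i * q ^ a + t < N" using tR RQ by linarith
    moreover have "0 < i * q ^ a + t" using i q by simp
    ultimately show False using dvd by (meson dvd_imp_le not_le)
  next
    case False
    \<comment> \<open>Multiplying by q^b turns q^a into q^(2l), which is 1 modulo N, and puts the
      power on t instead. As b < l strictly, 2 q^b \<le> Q absorbs the factor 2 in t \<le> 2
      R.\<close>
    define b where "b = 2 * l - a"
    have ab: "a + b = 2 * l" "Suc b \<le> l" using a False by (auto simp: b_def)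
    have "q ^ b * (i * q ^ a + t) = i * q ^ (a + b) + t * q ^ b"
      by (simp add: power_add algebra_simps)
    also have "\<dots> = N * i + (i + t * q ^ b)"
      unfolding ab N by (simp add: algebra_simps)
    finally have "N dvd N * i + (i + t * q ^ b)"
      using dvd by (metis dvd_mult)
    then have dvd': "N dvd i + t * q ^ b"
      using dvd_add_right_iff[of N "N * i"] by simp
    have "2 * q ^ b \<le> q ^ Suc b" using q by simp
    also have "\<dots> \<le> Q" unfolding Q(1) using ab q by (intro power_increasing) auto
    finally have "R * (2 * q ^ b) \<le> R * Q" by (intro mult_le_mono order_refl)
    moreover have "t * q ^ b \<le> (2 * R) * q ^ b" using tR by (intro mult_le_mono order_refl)
    ultimately have "t * q ^ b \<le> R * Q" by (simp only: ac_simps)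
    then have "i + t * q ^ b < N" using iR RQ by linarith
    moreover have "0 < i + t * q ^ b" using i by simp
    ultimately show False using dvd' by (meson dvd_imp_le not_le)
  qed
qed

locale dual_containing_bch =
  fixes \<phi> :: "'a::{field_gcd,finite} \<Rightarrow> 'b::{field,finite}" and \<beta> :: 'b and q s l n Q :: nat
    and g h :: "'a poly"
  assumes hom: "field_hom \<phi>"
    and card_a: "card (UNIV :: 'a set) = q" and q: "q = 2 ^ s" "1 \<le> s"
    and card_b: "card (UNIV :: 'b set) = q ^ (2 * l)"
    and n_def: "n = q ^ (2 * l) - 1" and \<beta>: "primitive_unity_root n \<beta>"
    and Q: "Q = q ^ l" "3 \<le> Q"
    and g_def: "g = bch_gen_poly \<phi> (Q - 1) 1 \<beta>"
    and h_def: "h = cyc_modulus n div g"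
begin

sublocale field_hom \<phi> by (rule hom)
sublocale P: map_poly_inj_idom_hom \<phi> ..

lemma char_a: "CHAR('a) = 2"
  by (rule CHAR_eq_2[of s]) (simp add: card_a q)

lemma char_b: "CHAR('b) = 2"
  by (rule CHAR_eq_2[of "s * (2 * l)"]) (simp add: card_b q power_mult)

lemma q_ge_2: "2 \<le> q"
  using power_increasing[of 1 s "2::nat"] q by simp

lemma n_pos: "0 < n"
  using \<beta> by (simp add: primitive_unity_root_def)

lemma l_pos: "0 < l"
  using Q by (cases l) auto

lemma n_eq: "n = (Q - 1) * (Q + 1)"
proof -
  have "q ^ (2 * l) = Q * Q" by (simp add: Q(1) mult_2 power_add)
  then show ?thesis by (simp add: n_def algebra_simps)
qed

lemma q_power_eq: "q ^ (2 * l) = n + 1"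
  using q_ge_2 by (simp add: n_def)

lemma map_cyc_modulus: "map_poly \<phi> (cyc_modulus n) = cyc_modulus n"
  by (intro poly_eqI) (simp add: coeff_map_poly coeff_cyc_modulus hom_minus)

lemma \<beta>_power_eq_1_iff: "\<beta> ^ k = 1 \<longleftrightarrow> n dvd k"
  by (rule primitive_unity_root_power_eq_1_iff[OF \<beta>])

lemma cyc_modulus_root: "poly (cyc_modulus n) (\<beta> ^ i) = 0"
  by (simp add: poly_cyc_modulus \<beta>_power_eq_1_iff flip: power_mult)

lemma algebraic: "\<exists>f. f \<noteq> 0 \<and> poly (map_poly \<phi> f) (\<beta> ^ i) = 0"
  using cyc_modulus_nonzero[OF n_pos] map_cyc_modulus cyc_modulus_root by metis

lemmas min_poly_power_dvd_iff = min_poly_dvd_iff[OF hom algebraic]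

lemma g_eq: "g = Lcm ((\<lambda>i. min_poly \<phi> (\<beta> ^ i)) ` {1..Q - 2})"
proof -
  have "{1..1 + int (Q - 1) - 2} = int ` {1..Q - 2}"
    using Q by (simp add: image_int_atLeastAtMost of_nat_diff)
  then show ?thesis by (simp add: g_def bch_gen_poly_def image_image)
qed

lemma g_dvd_iff: "g dvd p \<longleftrightarrow> (\<forall>i\<in>{1..Q - 2}. poly (map_poly \<phi> p) (\<beta> ^ i) = 0)"
  by (simp add: g_eq Lcm_dvd_iff min_poly_power_dvd_iff)

lemma gh: "g * h = cyc_modulus n"
proof -
  have "g dvd cyc_modulus n" by (simp add: g_dvd_iff map_cyc_modulus cyc_modulus_root)
  then show ?thesis by (simp add: h_def)
qed

lemma g_nonzero: "g \<noteq> 0"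
  using gh cyc_modulus_nonzero[OF n_pos, where 'a='a] by auto

lemma monic_g: "lead_coeff g = 1"
proof -
  have "normalize g = g" by (simp add: g_eq)
  then have "lead_coeff g div unit_factor (lead_coeff g) = lead_coeff g"
    by (metis coeff_normalize)
  moreover have "is_unit (lead_coeff g)" using g_nonzero by (simp add: dvd_field_iff)
  ultimately show ?thesis
    by (metis is_unit_normalize unit_factor_mult_normalize mult_1_right div_self not_is_unit_0)
qed

lemma map_gh: "map_poly \<phi> g * map_poly \<phi> h = cyc_modulus n"
  by (metis P.hom_mult gh map_cyc_modulus)

lemma poly_map_gh: "poly (map_poly \<phi> g) x * poly (map_poly \<phi> h) x = x ^ n - 1"
  using arg_cong[OF map_gh, of "\<lambda>p. poly p x"] by (simp add: poly_cyc_modulus)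

text \<open>The least common multiple divides the product, so a root of \<open>g\<close> is a root
  of the minimal polynomial of some \<beta>^i. Since q^(2l) = n + 1, the 2l-fold Frobenius fixes
  \<beta>^i, and the roots are its conjugates.\<close>

lemma root_g:
  assumes "poly (map_poly \<phi> g) z = 0"
  obtains i a where "i \<in> {1..Q - 2}" "a < 2 * l" "z = \<beta> ^ (i * q ^ a)"
proof -
  have "g dvd (\<Prod>i\<in>{1..Q - 2}. min_poly \<phi> (\<beta> ^ i))"
    unfolding g_eq by (rule Lcm_least) (auto intro: dvd_prodI)
  then have "map_poly \<phi> g dvd (\<Prod>i\<in>{1..Q - 2}. map_poly \<phi> (min_poly \<phi> (\<beta> ^ i)))"
    using P.hom_dvd by (metis P.hom_prod)
  then have "(\<Prod>i\<in>{1..Q - 2}. poly (map_poly \<phi> (min_poly \<phi> (\<beta> ^ i))) z) = 0"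
    using assms by (auto elim!: dvdE simp flip: poly_prod)
  then obtain i where i: "i \<in> {1..Q - 2}" "poly (map_poly \<phi> (min_poly \<phi> (\<beta> ^ i))) z = 0"
    by auto
  have "(\<beta> ^ i) ^ (q ^ (2 * l)) = (\<beta> ^ i) ^ (n + 1)" by (simp only: q_power_eq)
  also have "\<dots> = \<beta> ^ i" using \<beta>_power_eq_1_iff[of "i * n"] by (simp add: power_mult)
  finally have y: "(\<beta> ^ i) ^ (card (UNIV :: 'a set) ^ (2 * l)) = \<beta> ^ i" by (simp add: card_a)
  obtain a where "a < 2 * l" "z = (\<beta> ^ i) ^ (card (UNIV :: 'a set) ^ a)"
    by (rule min_poly_root_conjugate[OF hom _ char_b y _ i(2), of s]) (use l_pos in \<open>auto simp: card_a q\<close>)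
  then show ?thesis using i that by (simp add: card_a power_mult)
qed

text \<open>The inverse of \<beta>^t is a root of x^n - 1 but, by the exponent estimate, not of
  \<open>g\<close>. So it is a root of \<open>h\<close>, and reversal inverts roots.\<close>

lemma root_reflect_h:
  assumes "t \<le> 2 * Q - 4" shows "poly (map_poly \<phi> (reflect_poly h)) (\<beta> ^ t) = 0"
proof -
  \<comment> \<open>Needed for the natural number n - t to serve as the exponent -t.\<close>
  have "t \<le> n"
  proof -
    obtain R where "Q = R + 3" using Q(2) by (metis add.commute le_iff_add)
    then show ?thesis using assms by (simp add: n_eq)
  qed
  then have prod: "\<beta> ^ (n - t) * \<beta> ^ t = 1"
    using \<beta>_power_eq_1_iff[of n] by (simp flip: power_add)
  have "poly (map_poly \<phi> g) (\<beta> ^ (n - t)) \<noteq> 0"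
  proof
    assume "poly (map_poly \<phi> g) (\<beta> ^ (n - t)) = 0"
    then obtain i a where ia: "i \<in> {1..Q - 2}" "a < 2 * l" "\<beta> ^ (n - t) = \<beta> ^ (i * q ^ a)"
      by (rule root_g)
    then have "n dvd i * q ^ a + t"
      using prod by (simp add: power_add flip: \<beta>_power_eq_1_iff)
    then show False
      using cyclotomic_exponent_not_dvd[OF q_ge_2 Q _ _ assms ia(2), of i] ia(1) by (simp add: n_def)
  qed
  moreover have "(\<beta> ^ (n - t)) ^ n - 1 = 0"
    using cyc_modulus_root[of "n - t"] by (simp add: poly_cyc_modulus)
  ultimately have "poly (map_poly \<phi> h) (\<beta> ^ (n - t)) = 0"
    using poly_map_gh[of "\<beta> ^ (n - t)"] by simp
  moreover have "inverse (\<beta> ^ t) = \<beta> ^ (n - t)" using prod by (metis inverse_unique mult.commute)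
  moreover have "map_poly \<phi> (reflect_poly h) = reflect_poly (map_poly \<phi> h)"
    by (intro poly_eqI) (simp add: coeff_map_poly coeff_reflect_poly)
  ultimately show ?thesis
    using primitive_unity_root_nonzero[OF \<beta>] by (simp add: poly_reflect_poly_nz)
qed

text \<open>A common root of \<open>g\<close> and \<open>h\<close> would be a double root of x^n - 1
  and kill the derivative n x^(n-1), but n is odd. So \<open>h\<close> vanishes at none of the roots
  \<beta>^i that test divisibility by \<open>g\<close>.\<close>

lemma coprime_g_h:
  assumes "g dvd v * h" shows "g dvd v"
  unfolding g_dvd_iff
proof
  fix i assume i: "i \<in> {1..Q - 2}"
  let ?G = "map_poly \<phi> g" and ?H = "map_poly \<phi> h" and ?x = "\<beta> ^ i"
  have g0: "poly ?G ?x = 0" using g_dvd_iff[of g] i by simp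
  have "poly ?H ?x \<noteq> 0"
  proof
    assume "poly ?H ?x = 0"
    then have "poly (pderiv (?G * ?H)) ?x = 0" using g0 by (simp add: pderiv_mult)
    moreover have "pderiv (?G * ?H) = Polynomial.monom (of_nat n) (n - 1)"
      unfolding map_gh cyc_modulus_def by (simp add: pderiv_diff pderiv_monom)
    ultimately have "of_nat n * ?x ^ (n - 1) = 0" by (simp add: poly_monom)
    then have "2 dvd n"
      using primitive_unity_root_nonzero[OF \<beta>] by (auto simp: of_nat_eq_0_iff_char_dvd char_b)
    moreover have "even (q ^ (2 * l))" using q l_pos by simp
    ultimately show False unfolding q_power_eq by simp
  qed
  moreover have "poly (map_poly \<phi> (v * h)) ?x = 0" using assms i g_dvd_iff by blast
  ultimately show "poly (map_poly \<phi> v) ?x = 0" by (simp add: P.hom_mult)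
qed

lemma hweight_map: "hweight (map_poly \<phi> p) = hweight p"
  by (simp add: hweight_def coeff_map_poly)

lemma bound_g:
  assumes "g dvd v" "v \<noteq> 0" "degree v < n" shows "Q - 1 \<le> hweight v"
proof -
  have "Q - 2 < hweight (map_poly \<phi> v)"
    by (rule bch_bound[OF \<beta>, of _ 1]) (use assms g_dvd_iff Q in auto)
  then show ?thesis by (simp add: hweight_map)
qed

lemma bound_reflect_h:
  assumes "reflect_poly h dvd v" "v \<noteq> 0" "degree v < n" shows "2 * (Q - 1) \<le> hweight v"
proof -
  have "map_poly \<phi> (reflect_poly h) dvd map_poly \<phi> v" using assms(1) by (rule P.hom_dvd)
  then have "poly (map_poly \<phi> v) (\<beta> ^ t) = 0" if "t \<le> 2 * Q - 4" for t
    using root_reflect_h[OF that] by (auto elim!: dvdE)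
  then have "2 * Q - 3 < hweight (map_poly \<phi> v)"
    by (intro bch_bound[OF \<beta>, of _ 0]) (use assms Q in auto)
  then show ?thesis by (simp add: hweight_map)
qed

text \<open>The exponents 1, ..., Q - 2 defining \<open>g\<close> lie in the range up to 2Q - 4, as
  Q is at least 2.\<close>

lemma g_dvd_reflect_h: "g dvd reflect_poly h"
  unfolding g_dvd_iff by (intro ballI root_reflect_h) auto

text \<open>Since \<open>Q - 1\<close> divides \<open>n\<close>, the BCH bound of \<open>g\<close> is attained by \<open>(x^n - 1) / (x^(Q + 1) - 1)\<close>.\<close>

lemma light_word:
  obtains w where "g dvd w" "w \<noteq> 0" "degree w < n" "hweight w \<le> Q - 1"
proof -
  define w :: "'a poly" where "w = (\<Sum>j<Q - 1. Polynomial.monom 1 (j * (Q + 1)))"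
  have "(Polynomial.monom 1 (Q + 1) - 1) * (\<Sum>j<Q - 1. Polynomial.monom 1 (Q + 1) ^ j) =
      Polynomial.monom 1 (Q + 1) ^ (Q - 1) - (1 :: 'a poly)"
    by (rule power_diff_1_eq[symmetric])
  then have w: "cyc_modulus (Q + 1) * w = cyc_modulus n"
    by (simp add: w_def cyc_modulus_def monom_power n_eq ac_simps)
  have w0: "w \<noteq> 0" using w cyc_modulus_nonzero[OF n_pos, where 'a='a] by auto
  have "degree (cyc_modulus (Q + 1) * w) = n" unfolding w by (rule degree_cyc_modulus)
  then have deg: "degree w < n"
    using w0 cyc_modulus_nonzero[of "Q + 1", where 'a='a] by (simp add: degree_mult_eq degree_cyc_modulus)
  have "{i. coeff w i \<noteq> 0} \<subseteq> (\<lambda>j. j * (Q + 1)) ` {..<Q - 1}"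
  proof
    fix i assume "i \<in> {i. coeff w i \<noteq> 0}"
    then have "(\<Sum>j<Q - 1. coeff (Polynomial.monom (1::'a) (j * (Q + 1))) i) \<noteq> 0"
      by (simp only: w_def coeff_sum) simp
    then obtain j where "j \<in> {..<Q - 1}" "coeff (Polynomial.monom (1::'a) (j * (Q + 1))) i \<noteq> 0"
      by (rule sum.not_neutral_contains_not_neutral)
    then show "i \<in> (\<lambda>j. j * (Q + 1)) ` {..<Q - 1}" by (auto split: if_splits)
  qed
  then have "hweight w \<le> card ((\<lambda>j. j * (Q + 1)) ` {..<Q - 1})"
    unfolding hweight_def by (rule card_mono[rotated]) simp
  also have "\<dots> \<le> Q - 1" using card_image_le[of "{..<Q - 1}" "\<lambda>j. j * (Q + 1)"] by simp
  finally have weight: "hweight w \<le> Q - 1" .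
  have "g dvd w" unfolding g_dvd_iff
  proof
    fix i assume i: "i \<in> {1..Q - 2}"
    have "map_poly \<phi> (cyc_modulus (Q + 1)) = cyc_modulus (Q + 1)"
      by (intro poly_eqI) (simp add: coeff_map_poly coeff_cyc_modulus hom_minus)
    then have "cyc_modulus (Q + 1) * map_poly \<phi> w = cyc_modulus n"
      using arg_cong[OF w, of "map_poly \<phi>"] by (simp add: P.hom_mult map_cyc_modulus)
    then have "((\<beta> ^ i) ^ (Q + 1) - 1) * poly (map_poly \<phi> w) (\<beta> ^ i) = 0"
      using cyc_modulus_root[of i] by (metis poly_cyc_modulus poly_mult)
    \<comment> \<open>Otherwise (Q - 1)(Q + 1) divides i (Q + 1), so Q - 1 divides i, although i
      lies between 1 and Q - 2. Hence the factor x^(Q + 1) - 1 takes none of the defining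
      roots.\<close>
    moreover have "(\<beta> ^ i) ^ (Q + 1) \<noteq> 1"
    proof
      assume "(\<beta> ^ i) ^ (Q + 1) = 1"
      then have "n dvd i * (Q + 1)" by (simp only: \<beta>_power_eq_1_iff flip: power_mult)
      then have "Q - 1 dvd i" unfolding n_eq
        by (simp only: mult.commute[of _ "Q + 1"] nat_mult_dvd_cancel_disj) simp
      then show False using i Q by (auto dest: dvd_imp_le)
    qed
    ultimately show "poly (map_poly \<phi> w) (\<beta> ^ i) = 0" by simp
  qed
  then show ?thesis using that w0 deg weight by blast
qed

end

theorem theorem11:
  fixes \<phi> :: "'a::{field_gcd,finite} \<Rightarrow> 'b::{field,finite}" and \<beta> :: 'b
    and q m n \<delta> :: nat and g h g_perp :: "'a poly" and C' :: "'a vec set"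
  assumes "card (UNIV :: 'a set) = q" and "\<exists>s\<ge>1. q = 2 ^ s"
    and "even m"
    and "card (UNIV :: 'b set) = q ^ m" and "field_hom \<phi>"
    and "n = q ^ m - 1" and "primitive_unity_root n \<beta>"
    and "\<delta> = q ^ (m div 2) - 1" and "\<delta> \<ge> 2"
    and "g = bch_gen_poly \<phi> \<delta> 1 \<beta>"
    and "h = cyc_modulus n div g"
    and "g_perp = Polynomial.smult (inverse (poly h 0)) (reflect_poly h)"
    and "C' = cyclic_code_of (2 * n) (g * g_perp)"
  shows "is_generator_poly n (bch_code \<phi> n \<delta> 1 \<beta>) g \<and>
         is_generator_poly n (euclidean_dual n (bch_code \<phi> n \<delta> 1 \<beta>)) g_perp \<and>
         is_generator_poly (2 * n) C' (g * g_perp) \<and>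
         cyclic_code (2 * n) C' \<and>
         self_dual (2 * n) C' \<and>
         code_params (2 * (q ^ m - 1)) (q ^ m - 1) (2 * (q ^ (m div 2) - 1)) C'"
proof -
  obtain s where s: "q = 2 ^ s" "1 \<le> s" using assms(2) by blast
  define l where "l = m div 2"
  define Q where "Q = q ^ l"
  have m: "m = 2 * l" using assms(3) by (simp add: l_def)
  have \<delta>: "\<delta> = Q - 1" using assms(8) by (simp add: Q_def l_def)
  interpret B: dual_containing_bch \<phi> \<beta> q s l n Q g h
    by (rule dual_containing_bch.intro) (use assms s m \<delta> in \<open>simp_all add: Q_def\<close>)
  interpret F: cyclic_factorization_char_2 n g h g_perp
    by unfold_locales
      (simp_all add: B.n_pos B.gh B.monic_g B.char_a assms(12) poly_0_coeff_0)
  have C: "bch_code \<phi> n \<delta> 1 \<beta> = cyclic_code_of n g"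
    by (simp add: bch_code_def assms(10))
  obtain w where w: "g dvd w" "w \<noteq> 0" "degree w < n" "hweight w \<le> Q - 1"
    by (rule B.light_word)
  \<comment> \<open>The two polynomials differ by the unit h(0), so the bounds for
    \<open>reflect_poly h\<close> carry over.\<close>
  have perp_dvd: "g_perp dvd p \<longleftrightarrow> reflect_poly h dvd p" for p
    by (simp add: F.reflect_h F.coeff_h_0 smult_dvd_iff)
  have "g dvd g_perp"
    using B.g_dvd_reflect_h F.coeff_h_0 by (simp add: F.reflect_h dvd_smult_iff)
  then have "min_dist C' = 2 * (Q - 1)"
    unfolding assms(13)
    by (rule F.min_dist_double[OF _ B.coprime_g_h B.bound_g B.bound_reflect_h w])
      (simp_all add: perp_dvd)
  \<comment> \<open>The generator has degree deg g + deg h = n, which leaves dimension 2n -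
    n.\<close>
  moreover have "linear_code (2 * n) C'" "code_dim (2 * n) C' = n"
    using linear_code_dim_cyclic_code_of[OF _ F.double_dvd] B.n_pos F.degree_double
    by (simp_all add: assms(13))
  moreover have "is_generator_poly (2 * n) C' (g * g_perp)"
    unfolding assms(13) by (rule F.is_generator_poly_double)
  moreover have "self_dual (2 * n) C'"
    unfolding assms(13) by (rule F.self_dual_double)
  moreover have "is_generator_poly n (cyclic_code_of n g) g"
    by (rule is_generator_poly_cyclic_code_of[OF B.n_pos F.g_dvd B.monic_g])
  moreover from calculation have "cyclic_code (2 * n) C'" by (simp add: is_generator_poly_def)
  ultimately show ?thesis
    using F.is_generator_poly_dual
    unfolding C code_params_def assms(6)[symmetric] assms(8)[symmetric] \<delta>[symmetric] by blast
qed

end
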